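(* Let $G$ be a connected graph with $p$ vertices and $q$ edges, and let $V(Tr')$ be the set of vertices of $G$ that do not lie in any triangle of $G$. Then: (1) if $G$ is triangle-free, the eccentricity matrix $\epsilon(C[G])$ is irreducible; (2) if $G$ is not triangle-free and $V(Tr')\neq\emptyset$, the eccentricity matrix $\epsilon(C[G])$ is irreducible.
   Context: All graphs are finite, simple, undirected and connected. For a connected graph $H$ with vertices $v_1,\ldots,v_n$, $d(v_i,v_j)$ is the distance and $e(v_i)=\max_j d(v_i,v_j)$ the eccentricity. The eccentricity matrix $\epsilon(H)$ has $(i,j)$ entry $d(v_i,v_j)$ if $d(v_i,v_j)=\min\{e(v_i),e(v_j)\}$ and $0$ otherwise. A square matrix $M$ is reducible if there is a permutation matrix $P$ with $M=P^T\begin{pmatrix}N_{11}&N_{12}\\0&N_{22}\end{pmatrix}P$ for nonempty square blocks $N_{11},N_{22}$; otherwise it is irreducible. The central graph $C[G]$ has vertex set $V(G)\cup I(G)$, where $I(G)=\{w_e:e\in E(G)\}$; its edges are $uw_e$ for each edge $e$ and each endpoint $u$ of $e$, and $uv$ for all distinct $u,v\in V(G)$ nonadjacent in $G$ (original edges of $G$ are not kept). *)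

theory Defs
  imports
    "Graph_Theory.Graph_Theory"
    "Jordan_Normal_Form.Matrix"
begin

text \<open>
  A finite simple undirected graph is a symmetric loop-free digraph without parallel arcs
  (locale \<^locale>\<open>pair_graph\<close>): an undirected edge \<open>uv\<close> is represented by the two arcs
  \<open>(u, v)\<close> and \<open>(v, u)\<close>. Library connectedness \<^const>\<open>connected\<close> includes having a vertex.
\<close>

definition uedges :: "'a pair_pre_digraph \<Rightarrow> 'a set set" where
  "uedges G = (\<lambda>(u, v). {u, v}) ` parcs G"

text \<open>
  \<open>wf_digraph.\<mu>\<close> is the library's weighted shortest-path distance; all arcs get weight 1. It is
  extended-real valued, and finite for any two vertices of a connected graph.
\<close>

definition gdist :: "'a pair_pre_digraph \<Rightarrow> 'a \<Rightarrow> 'a \<Rightarrow> real" where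
  "gdist H u v = real_of_ereal (wf_digraph.\<mu> (with_proj H) (\<lambda>_. 1) u v)"

lemma gdist_eq_walk_length:
  assumes "pair_graph H" "connected H" "u \<in> pverts H" "v \<in> pverts H"
  shows "gdist H u v = real (LEAST n. \<exists>p. pre_digraph.awalk (with_proj H) u p v \<and> length p = n)"
proof -
  interpret pair_graph H by fact
  obtain p0 where p0: "awalk u p0 v" 
    using connected_awalkE[OF assms(2)] assms(3,4) mk_symmetric_awalk_imp_awalk[OF sym_arcs]
    by (metis with_proj_simps(1))
  let ?P = "\<lambda>n. \<exists>p. awalk u p v \<and> length p = n"
  have c: "awalk_cost (\<lambda>_. 1) p = real (length p)" for p :: "('a \<times> 'a) list"
    by (induction p) (auto simp: awalk_cost_def)
  obtain p where p: "awalk u p v" "length p = Least ?P" using LeastI_ex[of ?P] p0 by auto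
  have "\<mu> (\<lambda>_. 1) u v = ereal (real (Least ?P))"
    unfolding \<mu>_def c
  proof (rule antisym)
    show "(INF p\<in>{p. awalk u p v}. ereal (real (length p))) \<le> ereal (real (Least ?P))"
      using p by (metis (mono_tags) INF_lower mem_Collect_eq)
    show "ereal (real (Least ?P)) \<le> (INF p\<in>{p. awalk u p v}. ereal (real (length p)))"
      by (rule INF_greatest) (auto intro!: Least_le)
  qed
  then show ?thesis by (simp add: gdist_def)
qed

definition eccentricity :: "'a pair_pre_digraph \<Rightarrow> 'a \<Rightarrow> real" where
  "eccentricity H u = Max (gdist H u ` pverts H)"

text \<open>
  The list \<open>vs\<close> is the chosen labelling \<open>v\<^sub>1, \<dots>, v\<^sub>n\<close> of the vertices of \<open>H\<close>, without repetitions.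
\<close>

definition ecc_mat :: "'a pair_pre_digraph \<Rightarrow> 'a list \<Rightarrow> real mat" where
  "ecc_mat H vs = mat (length vs) (length vs) (\<lambda>(i, j).
     if gdist H (vs ! i) (vs ! j) = min (eccentricity H (vs ! i)) (eccentricity H (vs ! j))
     then gdist H (vs ! i) (vs ! j) else 0)"

definition permutation_matrix :: "nat \<Rightarrow> 'a :: semiring_1 mat \<Rightarrow> bool" where
  "permutation_matrix n P \<longleftrightarrow>
     (\<exists>\<pi>. \<pi> permutes {0..<n} \<and> P = mat n n (\<lambda>(i, j). if i = \<pi> j then 1 else 0))"

definition reducible_mat :: "'a :: semiring_1 mat \<Rightarrow> bool" where
  "reducible_mat M \<longleftrightarrow>
     (\<exists>k l P N11 N12 N22. 0 < k \<and> 0 < l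
        \<and> permutation_matrix (k + l) P
        \<and> N11 \<in> carrier_mat k k \<and> N12 \<in> carrier_mat k l \<and> N22 \<in> carrier_mat l l
        \<and> M = transpose_mat P * four_block_mat N11 N12 (0\<^sub>m l k) N22 * P)"

definition irreducible_mat :: "'a :: semiring_1 mat \<Rightarrow> bool" where
  "irreducible_mat M \<longleftrightarrow> square_mat M \<and> \<not> reducible_mat M"

text \<open>
  The vertex \<open>w\<^sub>e\<close> added for the edge \<open>e\<close> is \<open>Inr e\<close>; the original vertex \<open>u\<close> is \<open>Inl u\<close>.
\<close>

definition central_graph :: "'a pair_pre_digraph \<Rightarrow> ('a + 'a set) pair_pre_digraph" where
  "central_graph G = \<lparr>
     pverts = Inl ` pverts G \<union> Inr ` uedges G,
     parcs = {(Inl u, Inr e) | u e. e \<in> uedges G \<and> u \<in> e}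
           \<union> {(Inr e, Inl u) | u e. e \<in> uedges G \<and> u \<in> e}
           \<union> {(Inl u, Inl v) | u v.
                u \<in> pverts G \<and> v \<in> pverts G \<and> u \<noteq> v \<and> (u, v) \<notin> parcs G} \<rparr>"

definition is_triangle :: "'a pair_pre_digraph \<Rightarrow> 'a set \<Rightarrow> bool" where
  "is_triangle G T \<longleftrightarrow>
     T \<subseteq> pverts G \<and> card T = 3 \<and> (\<forall>u\<in>T. \<forall>v\<in>T. u \<noteq> v \<longrightarrow> (u, v) \<in> parcs G)"

definition triangle_free :: "'a pair_pre_digraph \<Rightarrow> bool" where
  "triangle_free G \<longleftrightarrow> (\<nexists>T. is_triangle G T)"

definition non_triangle_verts :: "'a pair_pre_digraph \<Rightarrow> 'a set" where
  "non_triangle_verts G = {x \<in> pverts G. \<nexists>T. is_triangle G T \<and> x \<in> T}"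

lemma pair_graph_central_graph:
  assumes "pair_graph G"
  shows "pair_graph (central_graph G)"
proof -
  interpret pair_graph G by fact
  have sub: "u \<in> pverts G" if "e \<in> uedges G" "u \<in> e" for e u
    using that by (auto simp: uedges_def dest: in_arcsD1 in_arcsD2)
  have fE: "finite (uedges G)"
    by (simp add: uedges_def)
  have fV: "finite (pverts (central_graph G))"
    using fE by (simp add: central_graph_def)
  have sV: "parcs (central_graph G) \<subseteq> pverts (central_graph G) \<times> pverts (central_graph G)"
    by (auto simp: central_graph_def dest: sub)
  have "sym (parcs (central_graph G))"
    by (auto simp: central_graph_def sym_def dest: arcs_symmetric)
  moreover have "finite (parcs (central_graph G))"
    using fV sV by (meson finite_SigmaI finite_subset)
  moreover have "fst a \<noteq> snd a" if "a \<in> parcs (central_graph G)" for a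
    using that by (auto simp: central_graph_def)
  moreover have "fst a \<in> pverts (central_graph G) \<and> snd a \<in> pverts (central_graph G)"
    if "a \<in> parcs (central_graph G)" for a
    using that sV by auto
  ultimately show ?thesis
    using fV by unfold_locales (simp_all add: symmetric_def)
qed

end

theory Submission
  imports Defs
begin

text \<open>
  A matrix is irreducible if the digraph of its nonzero entries is strongly connected, so it is
  enough to join every vertex of \<open>C[G]\<close> to a fixed vertex \<open>x\<close> of \<open>G\<close> lying in no triangle, along
  nonzero entries of the eccentricity matrix. Such entries arise at a pair \<open>a, b\<close> whenever \<open>b\<close> is
  at maximal distance from \<open>a\<close>. A vertex \<open>u\<close> in no triangle has eccentricity 2 in \<open>C[G]\<close>, attained
  at its \<open>G\<close>-neighbours and at every \<open>w\<^sub>e\<close> with \<open>u \<notin> e\<close>; a vertex \<open>u\<close> of a triangle \<open>uab\<close> is at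
  maximal distance 3 from \<open>w\<^sub>a\<^sub>b\<close>, which is joined to \<open>x\<close>. Connectedness of \<open>G\<close> thus joins all
  original vertices to \<open>x\<close>. For \<open>e \<ni> x\<close>, a farthest vertex from \<open>w\<^sub>e\<close> is \<open>w\<^sub>f\<close> for an edge \<open>f\<close>
  disjoint from \<open>e\<close> if there is one, otherwise any original vertex outside \<open>e\<close>, otherwise \<open>x\<close> itself.
\<close>

section \<open>Irreducibility from paths along nonzero entries\<close>

text \<open>Column \<open>j\<close> of \<open>P\<close> is the unit vector at index
  \<open>\<pi> j\<close>, so each of the two products collapses to a single summand.\<close>

lemma permutation_matrix_conjugate_index:
  assumes "\<pi> permutes {0..<n}" and "P = mat n n (\<lambda>(i, j). if i = \<pi> j then 1 else 0)"
    and N: "N \<in> carrier_mat n n" and ij: "i < n" "j < n"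
  shows "(transpose_mat P * N * P) $$ (i, j) = (N $$ (\<pi> i, \<pi> j) :: 'a :: semiring_1)"
proof -
  have pi: "\<pi> i < n" "\<pi> j < n"
    using permutes_in_image[OF assms(1)] ij by auto
  have P: "P \<in> carrier_mat n n" using assms(2) by simp
  have mult: "(A * B) $$ (i, j) = (\<Sum>a = 0..<n. A $$ (i, a) * B $$ (a, j))"
    if "A \<in> carrier_mat n n" "B \<in> carrier_mat n n" "i < n" "j < n" for A B :: "'a mat" and i j
    using that by (simp add: scalar_prod_def)
  have 1: "(transpose_mat P * N) $$ (i, b) = N $$ (\<pi> i, b)" if "b < n" for b
  proof -
    have "(transpose_mat P * N) $$ (i, b) = (\<Sum>a = 0..<n. P $$ (a, i) * N $$ (a, b))"
      using P N ij that by (subst mult) auto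
    also have "\<dots> = (\<Sum>a = 0..<n. (if a = \<pi> i then N $$ (a, b) else 0))"
      by (rule sum.cong) (use ij in \<open>auto simp: assms(2)\<close>)
    finally show ?thesis using pi by simp
  qed
  have "(transpose_mat P * N * P) $$ (i, j)
      = (\<Sum>b = 0..<n. (transpose_mat P * N) $$ (i, b) * P $$ (b, j))"
    using P N ij by (intro mult) auto
  also have "\<dots> = (\<Sum>b = 0..<n. (if b = \<pi> j then N $$ (\<pi> i, b) else 0))"
    by (rule sum.cong) (use ij 1 in \<open>auto simp: assms(2) simp del: index_mult_mat(1)\<close>)
  finally show ?thesis using pi by simp
qed

text \<open>In block form the rows of the lower block vanish on the first \<open>k\<close> columns.
  Hence the indices that \<open>\<pi>\<close> sends outside the first block are closed under nonzero
  entries, and no path leads from the preimage of \<open>k\<close> to the preimage of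
  \<open>0\<close>.\<close>

lemma irreducible_matI:
  assumes M: "M \<in> carrier_mat n n"
    and conn: "\<And>i j. i < n \<Longrightarrow> j < n \<Longrightarrow> (i, j) \<in> {(i, j). i < n \<and> j < n \<and> M $$ (i, j) \<noteq> 0}\<^sup>*"
  shows "irreducible_mat M"
  unfolding irreducible_mat_def
proof
  show "square_mat M" using M by simp
  show "\<not> reducible_mat M"
  proof
    assume "reducible_mat M"
    then obtain k l P N11 N12 N22 where kl: "0 < k" "0 < l" and perm: "permutation_matrix (k + l) P"
      and N: "N11 \<in> carrier_mat k k" "N12 \<in> carrier_mat k l" "N22 \<in> carrier_mat l l"
      and M_eq: "M = transpose_mat P * four_block_mat N11 N12 (0\<^sub>m l k) N22 * P"
      unfolding reducible_mat_def by blast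
    let ?N = "four_block_mat N11 N12 (0\<^sub>m l k) N22"
    have Nc: "?N \<in> carrier_mat (k + l) (k + l)" using N by simp
    from perm obtain \<pi> where pi: "\<pi> permutes {0..<k + l}"
      and P: "P = mat (k + l) (k + l) (\<lambda>(i, j). if i = \<pi> j then 1 else 0)"
      unfolding permutation_matrix_def by blast
    have n: "n = k + l" using M M_eq P by auto
    have entry: "M $$ (i, j) = ?N $$ (\<pi> i, \<pi> j)" if "i < n" "j < n" for i j
      unfolding M_eq using permutation_matrix_conjugate_index[OF pi P Nc] that n by blast
    have less: "\<pi> i < k + l" if "i < n" for i
      using permutes_in_image[OF pi, of i] that n by auto
    have zero: "M $$ (i, j) = 0" if "i < n" "j < n" "\<not> \<pi> i < k" "\<pi> j < k" for i j
      using entry[OF that(1,2)] less[OF that(1)] less[OF that(2)] that N by auto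
    obtain i j where i: "\<pi> i = k" and j: "\<pi> j = 0"
      using permutes_surj[OF pi] by (metis surjD)
    have ij: "i < n" "j < n"
      using permutes_in_image[OF pi, of i] permutes_in_image[OF pi, of j] i j kl n by auto
    have "\<not> \<pi> a < k" if "(i, a) \<in> {(i, j). i < n \<and> j < n \<and> M $$ (i, j) \<noteq> 0}\<^sup>*" for a
      using that by induction (use i zero in auto)
    from this[OF conn[OF ij]] show False using j kl by simp
  qed
qed

text \<open>The support of the eccentricity matrix as a relation on vertices, free of any labelling,
  so that paths can be built in the graph itself.\<close>

definition ecc_rel :: "'a pair_pre_digraph \<Rightarrow> ('a \<times> 'a) set" where
  "ecc_rel H = {(a, b). a \<in> pverts H \<and> b \<in> pverts H \<and> gdist H a b \<noteq> 0
     \<and> gdist H a b = min (eccentricity H a) (eccentricity H b)}"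

lemma irreducible_ecc_mat:
  assumes vs: "distinct vs" "set vs = pverts H"
    and conn: "\<And>a b. a \<in> pverts H \<Longrightarrow> b \<in> pverts H \<Longrightarrow> (a, b) \<in> (ecc_rel H)\<^sup>*"
  shows "irreducible_mat (ecc_mat H vs)"
proof (rule irreducible_matI)
  let ?n = "length vs" and ?M = "ecc_mat H vs"
  let ?R = "{(i, j). i < ?n \<and> j < ?n \<and> ?M $$ (i, j) \<noteq> 0}"
  show "?M \<in> carrier_mat ?n ?n" by (simp add: ecc_mat_def)
  fix i j assume ij: "i < ?n" "j < ?n"
  \<comment> \<open>The path is lifted to indices one vertex at a time; distinctness of
    \<open>vs\<close> then identifies the last index with \<open>j\<close>.\<close>
  have "\<exists>k < ?n. vs ! k = b \<and> (i, k) \<in> ?R\<^sup>*" if "(vs ! i, b) \<in> (ecc_rel H)\<^sup>*" for b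
    using that
  proof induction
    case base
    then show ?case using ij by blast
  next
    case (step b c)
    then obtain k where k: "k < ?n" "vs ! k = b" "(i, k) \<in> ?R\<^sup>*" by blast
    obtain m where m: "m < ?n" "vs ! m = c"
      using step(2) vs(2) by (metis (no_types, lifting) case_prodD ecc_rel_def in_set_conv_nth mem_Collect_eq)
    have "(k, m) \<in> ?R" using k m step(2) by (auto simp: ecc_mat_def ecc_rel_def)
    then have "(i, m) \<in> ?R\<^sup>*" using k(3) by (rule rtrancl_into_rtrancl[rotated])
    then show ?case using m by blast
  qed
  moreover have "(vs ! i, vs ! j) \<in> (ecc_rel H)\<^sup>*"
    using conn ij vs(2) nth_mem by blast
  ultimately obtain k where "k < ?n" "vs ! k = vs ! j" "(i, k) \<in> ?R\<^sup>*" by blast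
  then show "(i, j) \<in> ?R\<^sup>*"
    using ij vs(1) by (simp add: nth_eq_iff_index_eq)
qed

section \<open>Distances as least exponents of powers of the arc relation\<close>

lemma sym_relpow: "sym R \<Longrightarrow> sym (R ^^ n)"
proof (induction n)
  case 0
  then show ?case by (auto intro: symI)
next
  case (Suc n)
  show ?case
  proof (rule symI)
    fix a b assume "(a, b) \<in> R ^^ Suc n"
    then obtain c where "(a, c) \<in> R ^^ n" "(c, b) \<in> R" by (rule relpow_Suc_E)
    then have "(c, a) \<in> R ^^ n" "(b, c) \<in> R" using Suc by (auto dest: symD)
    then show "(b, a) \<in> R ^^ Suc n" by (blast intro: relpow_Suc_I2)
  qed
qed

text \<open>Splitting off the first arc matches composition of relations. The hypothesis on
  \<open>u\<close> settles \<open>n = 0\<close>, since an empty walk has to start at a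
  vertex.\<close>

lemma (in pair_graph) awalk_iff_relpow:
  assumes "u \<in> pverts G"
  shows "(\<exists>p. awalk u p v \<and> length p = n) \<longleftrightarrow> (u, v) \<in> parcs G ^^ n"
  using assms
proof (induction n arbitrary: u)
  case 0
  then show ?case by (auto simp: awalk_Nil_iff)
next
  case (Suc n)
  have "(\<exists>p. awalk u p v \<and> length p = Suc n)
      \<longleftrightarrow> (\<exists>w. (u, w) \<in> parcs G \<and> (\<exists>p. awalk w p v \<and> length p = n))"
  proof
    assume "\<exists>p. awalk u p v \<and> length p = Suc n"
    then obtain a p where "awalk u (a # p) v" "length p = n" by (auto simp: length_Suc_conv)
    then show "\<exists>w. (u, w) \<in> parcs G \<and> (\<exists>p. awalk w p v \<and> length p = n)"
      by (cases a) (auto simp: awalk_Cons_iff)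
  next
    assume "\<exists>w. (u, w) \<in> parcs G \<and> (\<exists>p. awalk w p v \<and> length p = n)"
    then obtain w p where "(u, w) \<in> parcs G" "awalk w p v" "length p = n" by blast
    then have "awalk u ((u, w) # p) v" "length ((u, w) # p) = Suc n" by (simp_all add: awalk_Cons_iff)
    then show "\<exists>p. awalk u p v \<and> length p = Suc n" by blast
  qed
  also have "\<dots> \<longleftrightarrow> (\<exists>w. (u, w) \<in> parcs G \<and> (w, v) \<in> parcs G ^^ n)"
    using Suc.IH by (metis in_arcsD2)
  finally show ?case by (metis relpow_Suc_I2 relpow_Suc_E2)
qed

locale connected_pair_graph = pair_graph H for H :: "'a pair_pre_digraph" +
  assumes conn: "connected H"
begin

lemma gdist_eq_Least:
  assumes "u \<in> pverts H" "v \<in> pverts H"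
  shows "gdist H u v = real (LEAST n. (u, v) \<in> parcs H ^^ n)"
  using gdist_eq_walk_length[OF pair_graph_axioms conn assms] awalk_iff_relpow[OF assms(1)] by simp

lemma gdist_le:
  assumes "(u, v) \<in> parcs H ^^ n" "u \<in> pverts H" "v \<in> pverts H"
  shows "gdist H u v \<le> n"
  using assms by (auto simp: gdist_eq_Least intro: Least_le)

text \<open>Connectedness makes the set of exponents nonempty, so its least element is attained.
  Lower bounds on distances then amount to excluding small exponents.\<close>

lemma gdist_relpow:
  assumes "u \<in> pverts H" "v \<in> pverts H"
  obtains n where "gdist H u v = real n" "(u, v) \<in> parcs H ^^ n"
proof -
  obtain p where "awalk u p v"
    using connected_awalkE[OF conn] assms mk_symmetric_awalk_imp_awalk[OF sym_arcs]
    by (metis with_proj_simps(1))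
  then have "\<exists>n. (u, v) \<in> parcs H ^^ n" using awalk_iff_relpow[OF assms(1)] by blast
  then show ?thesis using that gdist_eq_Least[OF assms] LeastI_ex by metis
qed

lemma gdist_sym:
  assumes "u \<in> pverts H" "v \<in> pverts H"
  shows "gdist H u v = gdist H v u"
proof -
  have "sym (parcs H)" using arcs_symmetric by (auto intro: symI)
  then have "(u, v) \<in> parcs H ^^ n \<longleftrightarrow> (v, u) \<in> parcs H ^^ n" for n
    using sym_relpow by (metis symE)
  then show ?thesis using assms by (simp add: gdist_eq_Least)
qed

lemma gdist_triangle:
  assumes "u \<in> pverts H" "v \<in> pverts H" "w \<in> pverts H"
  shows "gdist H u w \<le> gdist H u v + gdist H v w"
proof -
  obtain m n where "gdist H u v = real m" "(u, v) \<in> parcs H ^^ m"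
    and "gdist H v w = real n" "(v, w) \<in> parcs H ^^ n"
    using gdist_relpow assms by metis
  then show ?thesis
    using gdist_le[of u w "m + n"] assms by (auto simp: relpow_add)
qed

lemma gdist_self: "u \<in> pverts H \<Longrightarrow> gdist H u u = 0"
  using gdist_eq_Least[of u u] by (simp add: Least_eq_0)

lemma gdist_arc_le: "(u, v) \<in> parcs H \<Longrightarrow> gdist H u v \<le> 1"
  using gdist_le[of u v 1] in_arcsD1 in_arcsD2 by fastforce

lemma gdist_ge_1:
  assumes "u \<in> pverts H" "v \<in> pverts H" "u \<noteq> v"
  shows "gdist H u v \<ge> 1"
  using gdist_relpow[OF assms(1,2)] assms(3)
  by (metis One_nat_def Suc_leI neq0_conv of_nat_1 of_nat_le_iff relpow_0_E)

lemma gdist_ge_2: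
  assumes "u \<in> pverts H" "v \<in> pverts H" "u \<noteq> v" "(u, v) \<notin> parcs H"
  shows "gdist H u v \<ge> 2"
proof -
  obtain n where n: "gdist H u v = real n" "(u, v) \<in> parcs H ^^ n"
    using gdist_relpow assms by metis
  then have "n \<noteq> 0" "n \<noteq> 1" using assms relpow_0_E relpow_1 by metis+
  then show ?thesis using n by simp
qed

lemma gdist_ge_3:
  assumes "u \<in> pverts H" "v \<in> pverts H" "u \<noteq> v" "(u, v) \<notin> parcs H"
    and "\<And>w. (u, w) \<in> parcs H \<Longrightarrow> (w, v) \<notin> parcs H"
  shows "gdist H u v \<ge> 3"
proof -
  obtain n where n: "gdist H u v = real n" "(u, v) \<in> parcs H ^^ n"
    using gdist_relpow assms by metis
  have "n \<noteq> 2"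
  proof
    assume "n = 2"
    then have "(u, v) \<in> parcs H O parcs H" using n by (simp add: numeral_2_eq_2)
    then show False using assms by auto
  qed
  moreover have "n \<noteq> 0" "n \<noteq> 1" using n assms relpow_0_E relpow_1 by metis+
  ultimately show ?thesis using n by simp
qed

lemma sym_ecc_rel: "sym (ecc_rel H)"
  by (rule symI) (auto simp: ecc_rel_def gdist_sym min.commute)

text \<open>Here \<open>b\<close> is farthest from \<open>a\<close>, so the distance is the
  eccentricity of \<open>a\<close>; by symmetry it is at most that of \<open>b\<close>, hence equals
  the minimum. Only one eccentricity ever has to be computed.\<close>

lemma ecc_relI:
  assumes ab: "a \<in> pverts H" "b \<in> pverts H" "a \<noteq> b"
    and far: "\<And>c. c \<in> pverts H \<Longrightarrow> gdist H a c \<le> k" "gdist H a b \<ge> k"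
  shows "(a, b) \<in> ecc_rel H"
proof -
  have "eccentricity H a = gdist H a b"
    unfolding eccentricity_def by (rule Max_eqI) (use ab far in \<open>auto intro: order_trans\<close>)
  moreover have "gdist H b a \<le> eccentricity H b"
    unfolding eccentricity_def using ab by auto
  ultimately show ?thesis
    using gdist_sym[OF ab(1,2)] gdist_ge_1[OF ab] ab by (auto simp: ecc_rel_def)
qed

end

section \<open>Connectedness of the central graph, and triangles of \<open>G\<close>\<close>

lemma central_graph_verts [simp]:
  "Inl u \<in> pverts (central_graph G) \<longleftrightarrow> u \<in> pverts G"
  "Inr e \<in> pverts (central_graph G) \<longleftrightarrow> e \<in> uedges G"
  by (auto simp: central_graph_def)

lemma central_graph_arcs [simp]:
  "(Inl u, Inr e) \<in> parcs (central_graph G) \<longleftrightarrow> e \<in> uedges G \<and> u \<in> e"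
  "(Inr e, Inl u) \<in> parcs (central_graph G) \<longleftrightarrow> e \<in> uedges G \<and> u \<in> e"
  "(Inl u, Inl v) \<in> parcs (central_graph G)
     \<longleftrightarrow> u \<in> pverts G \<and> v \<in> pverts G \<and> u \<noteq> v \<and> (u, v) \<notin> parcs G"
  "(Inr e, Inr f) \<notin> parcs (central_graph G)"
  by (auto simp: central_graph_def)

context pair_graph
begin

lemma uedgeE:
  assumes "e \<in> uedges G"
  obtains u v where "e = {u, v}" "(u, v) \<in> parcs G" "u \<in> pverts G" "v \<in> pverts G" "u \<noteq> v"
proof -
  from assms obtain u v where "e = {u, v}" "(u, v) \<in> parcs G" by (auto simp: uedges_def)
  then show thesis using that no_loops' in_arcsD1 in_arcsD2 by metis
qed

lemma uedgeI: "(u, v) \<in> parcs G \<Longrightarrow> {u, v} \<in> uedges G"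
  by (auto simp: uedges_def)

lemma connected_central_graph:
  assumes "pverts G \<noteq> {}"
  shows "connected (central_graph G)"
proof -
  interpret C: pair_graph "central_graph G"
    by (rule pair_graph_central_graph) unfold_locales
  let ?R = "parcs (central_graph G)"
  have Inl: "(Inl u, Inl v) \<in> ?R\<^sup>*" if "u \<in> pverts G" "v \<in> pverts G" for u v
  proof (cases "(u, v) \<in> parcs G")
    case True
    then have "(Inl u, Inr {u, v}) \<in> ?R" "(Inr {u, v}, Inl v) \<in> ?R"
      by (simp_all add: uedgeI)
    then show ?thesis by (meson r_into_rtrancl rtrancl_trans)
  next
    case False
    then show ?thesis using that by (cases "u = v") auto
  qed
  have ex: "\<exists>u \<in> pverts G. (a, Inl u) \<in> ?R\<^sup>* \<and> (Inl u, a) \<in> ?R\<^sup>*" if "a \<in> pverts (central_graph G)" for a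
  proof (cases a)
    case (Inl u)
    then show ?thesis using that by auto
  next
    case (Inr e)
    then have e: "e \<in> uedges G" using that by simp
    then obtain u v where "e = {u, v}" "u \<in> pverts G" by (rule uedgeE)
    then show ?thesis using e Inr by (auto intro!: bexI[of _ u])
  qed
  have all: "(a, b) \<in> ?R\<^sup>*" if "a \<in> pverts (central_graph G)" "b \<in> pverts (central_graph G)" for a b
    using ex[OF that(1)] ex[OF that(2)] Inl by (meson rtrancl_trans)
  have "a \<rightarrow>\<^sup>*\<^bsub>with_proj (central_graph G)\<^esub> b" if "a \<in> pverts (central_graph G)" "b \<in> pverts (central_graph G)" for a b
  proof -
    have "\<exists>n. (a, b) \<in> ?R ^^ n" by (rule rtrancl_imp_relpow[OF all[OF that]])
    then show ?thesis using C.awalk_iff_relpow[OF that(1)] by (auto simp: C.reachable_awalk)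
  qed
  \<comment> \<open>\<open>connected\<close> means strong connectedness of the symmetric closure,
    whose reachability agrees with that of the symmetric digraph itself.\<close>
  then show ?thesis
    using assms C.reachable_mk_symmetric_eq[OF C.sym_arcs]
    by (auto simp: connected_def strongly_connected_def central_graph_def)
qed

text \<open>Two ends of \<open>e\<close> both adjacent to \<open>u\<close> would form a triangle
  with it. The case \<open>s = u\<close> is allowed. The end \<open>s\<close> serves as a stop on a
  short route from \<open>Inl u\<close> to \<open>Inr e\<close>.\<close>

lemma non_triangle_vert_edge:
  assumes "u \<in> non_triangle_verts G" "e \<in> uedges G"
  obtains s where "s \<in> e" "(u, s) \<notin> parcs G"
proof -
  obtain s t where e: "e = {s, t}" and st: "(s, t) \<in> parcs G" "s \<in> pverts G" "t \<in> pverts G" "s \<noteq> t"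
    using assms(2) by (rule uedgeE)
  have "\<not> ((u, s) \<in> parcs G \<and> (u, t) \<in> parcs G)"
  proof
    assume adj: "(u, s) \<in> parcs G \<and> (u, t) \<in> parcs G"
    then have "u \<noteq> s" "u \<noteq> t" "u \<in> pverts G" using no_loops' in_arcsD1 by blast+
    then have "is_triangle G {u, s, t}"
      using adj st arcs_symmetric unfolding is_triangle_def by auto
    then show False using assms(1) by (auto simp: non_triangle_verts_def)
  qed
  then show thesis using that e by auto
qed

text \<open>The other two vertices of a triangle through \<open>u\<close> serve as \<open>a\<close>
  and \<open>b\<close>; lying in that triangle, they differ from every non-triangle vertex.\<close>

lemma triangle_opposite_edge:
  assumes "u \<in> pverts G" "u \<notin> non_triangle_verts G"
  obtains a b where "{a, b} \<in> uedges G" "(u, a) \<in> parcs G" "(u, b) \<in> parcs G" "u \<notin> {a, b}"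
    "\<And>x. x \<in> non_triangle_verts G \<Longrightarrow> x \<notin> {a, b}"
proof -
  obtain T where T: "is_triangle G T" "u \<in> T"
    using assms by (auto simp: non_triangle_verts_def)
  then have "card (T - {u}) = 2"
    by (simp add: is_triangle_def card_Diff_singleton)
  then obtain a b where ab: "T - {u} = {a, b}" "a \<noteq> b" by (auto simp: card_2_iff)
  show thesis
  proof (rule that)
    show "u \<notin> {a, b}" using ab by blast
    have "a \<in> T" "b \<in> T" "a \<noteq> u" "b \<noteq> u" using ab by blast+
    then show "(u, a) \<in> parcs G" "(u, b) \<in> parcs G" "{a, b} \<in> uedges G"
      using T ab(2) by (simp_all add: is_triangle_def uedgeI)
    show "x \<notin> {a, b}" if "x \<in> non_triangle_verts G" for x
      using that T ab unfolding non_triangle_verts_def by blast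
  qed
qed

section \<open>Joining every vertex of the central graph to \<open>x\<close>\<close>

lemma ecc_rel_central_graph_connected:
  assumes conn: "connected G" and x: "x \<in> non_triangle_verts G"
    and ab: "a \<in> pverts (central_graph G)" "b \<in> pverts (central_graph G)"
  shows "(a, b) \<in> (ecc_rel (central_graph G))\<^sup>*"
proof -
  let ?C = "central_graph G"
  let ?d = "gdist ?C" and ?E = "ecc_rel ?C"
  have xV: "x \<in> pverts G" using x by (simp add: non_triangle_verts_def)
  interpret C: connected_pair_graph ?C
    using xV connected_central_graph pair_graph_central_graph[OF pair_graph_axioms]
    by (auto simp: connected_pair_graph_def connected_pair_graph_axioms_def)
  have sub: "s \<in> pverts G" if "s \<in> e" "e \<in> uedges G" for s e
    using that(2) by (rule uedgeE) (use that(1) in auto)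

  \<comment> \<open>This includes \<open>u = v\<close>, at distance 0, so that \<open>VW2\<close>
    below also covers an end \<open>s\<close> equal to \<open>u\<close>.\<close>
  have VV_nonadj: "?d (Inl u) (Inl v) \<le> 1"
    if "u \<in> pverts G" "v \<in> pverts G" "(u, v) \<notin> parcs G" for u v
    using that C.gdist_arc_le[of "Inl u" "Inl v"] C.gdist_self[of "Inl u"] by (cases "u = v") auto
  have VV: "?d (Inl u) (Inl v) \<le> 2" if "u \<in> pverts G" "v \<in> pverts G" for u v
  proof (cases "(u, v) \<in> parcs G")
    case True
    then have "{u, v} \<in> uedges G" by (rule uedgeI)
    then show ?thesis
      using that C.gdist_triangle[of "Inl u" "Inr {u, v}" "Inl v"]
        C.gdist_arc_le[of "Inl u" "Inr {u, v}"] C.gdist_arc_le[of "Inr {u, v}" "Inl v"] by auto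
  next
    case False
    then show ?thesis using VV_nonadj[OF that] by simp
  qed
  have via_end: "?d a (Inr e) \<le> ?d a (Inl s) + 1"
    if "a \<in> pverts ?C" "e \<in> uedges G" "s \<in> e" for a e s
    using that C.gdist_triangle[of a "Inl s" "Inr e"] C.gdist_arc_le[of "Inl s" "Inr e"] sub by auto
  have VW2: "?d (Inl u) (Inr e) \<le> 2"
    if "u \<in> pverts G" "e \<in> uedges G" "s \<in> e" "(u, s) \<notin> parcs G" for u e s
    using that VV_nonadj[of u s] via_end[of "Inl u" e s] sub by force
  have VW3: "?d (Inl u) (Inr e) \<le> 3" if "u \<in> pverts G" "e \<in> uedges G" for u e
    using that(2) by (rule uedgeE) (use that VV via_end[of "Inl u" e] in force)
  have WV: "?d (Inr e) (Inl u) = ?d (Inl u) (Inr e)" if "u \<in> pverts G" "e \<in> uedges G" for u e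
    using C.gdist_sym that by simp

  have nt_far: "?d (Inl u) c \<le> 2" if u: "u \<in> non_triangle_verts G" and c: "c \<in> pverts ?C" for u c
  proof (cases c)
    case (Inl v)
    then show ?thesis using VV u c by (auto simp: non_triangle_verts_def)
  next
    case (Inr e)
    then have e: "e \<in> uedges G" using c by simp
    obtain s where "s \<in> e" "(u, s) \<notin> parcs G" using non_triangle_vert_edge[OF u e] .
    then show ?thesis using VW2 u e Inr by (auto simp: non_triangle_verts_def)
  qed
  \<comment> \<open>Arcs of \<open>G\<close> are dropped in the central graph, so the distance is at
    least 2, which is maximal by \<open>nt_far\<close>.\<close>
  have nt_VV: "(Inl u, Inl v) \<in> ?E" if "u \<in> non_triangle_verts G" "(u, v) \<in> parcs G" for u v
    using that in_arcsD1 in_arcsD2 no_loops'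
    by (intro C.ecc_relI[where k = 2] nt_far C.gdist_ge_2) auto
  have nt_VW: "(Inl u, Inr e) \<in> ?E" if "u \<in> non_triangle_verts G" "e \<in> uedges G" "u \<notin> e" for u e
    using that by (intro C.ecc_relI[where k = 2] nt_far C.gdist_ge_2)
      (auto simp: non_triangle_verts_def)

  let ?Q = "\<lambda>a. (a, Inl x) \<in> ?E\<^sup>*"
  have sym: "(b, a) \<in> ?E" if "(a, b) \<in> ?E" for a b
    using that C.sym_ecc_rel by (rule symD[rotated])
  have Q_step: "?Q a" if "(a, b) \<in> ?E" "?Q b" for a b
    using that by (rule converse_rtrancl_into_rtrancl)
  have Q_edge: "?Q (Inr e)" if "e \<in> uedges G" "x \<notin> e" for e
    using sym[OF nt_VW[OF x that]] by blast

  have Q_vert: "?Q (Inl u)" if "u \<in> pverts G" for u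
  proof -
    have "x \<rightarrow>\<^sup>*\<^bsub>with_proj G\<^esub> u"
      using conn xV that reachable_mk_symmetric_eq[OF sym_arcs]
      unfolding connected_def strongly_connected_def by simp
    then show ?thesis
    proof (induction rule: reachable_induct)
      case base
      show ?case by blast
    next
      case (step v u)
      then have arc: "(u, v) \<in> parcs G" and u: "u \<in> pverts G"
        using arcs_symmetric in_arcsD2 by auto
      show ?case
      proof (cases "u \<in> non_triangle_verts G")
        case True
        then show ?thesis using nt_VV arc step.IH Q_step by blast
      next
        \<comment> \<open>The induction hypothesis is bypassed here: \<open>Inl u\<close> reaches
          \<open>Inl x\<close> through \<open>Inr {a, b}\<close>, whose edge avoids
          \<open>x\<close>.\<close>
        case False
        obtain a b where *: "{a, b} \<in> uedges G" "(u, a) \<in> parcs G" "(u, b) \<in> parcs G" "u \<notin> {a, b}"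
          and "x \<notin> {a, b}"
          using triangle_opposite_edge[OF u False] x by metis
        have "(Inl u, Inr {a, b}) \<in> ?E"
        proof (rule C.ecc_relI[where k = 3])
          show "?d (Inl u) c \<le> 3" if "c \<in> pverts ?C" for c
            using that VV[OF u] VW3[OF u] by (cases c) force+
          \<comment> \<open>The only neighbours of \<open>Inr {a, b}\<close> are
            \<open>Inl a\<close> and \<open>Inl b\<close>, and neither is adjacent to
            \<open>Inl u\<close>, since \<open>a\<close> and \<open>b\<close> are neighbours of
            \<open>u\<close> in \<open>G\<close>.\<close>
          show "3 \<le> ?d (Inl u) (Inr {a, b})"
          proof (rule C.gdist_ge_3)
            show "(w, Inr {a, b}) \<notin> parcs ?C" if "(Inl u, w) \<in> parcs ?C" for w
              using that * by (cases w) auto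
          qed (use * u in auto)
        qed (use * u in auto)
        then show ?thesis using Q_edge[OF *(1) \<open>x \<notin> {a, b}\<close>] Q_step by blast
      qed
    qed
  qed

  have Q_spoke: "?Q (Inr e)" if e: "e \<in> uedges G" and xe: "x \<in> e" for e
  proof (cases "\<exists>f \<in> uedges G. e \<inter> f = {}")
    case True
    then obtain f where f: "f \<in> uedges G" "e \<inter> f = {}" by blast
    have "(Inr e, Inr f) \<in> ?E"
    proof (rule C.ecc_relI[where k = 3])
      show "?d (Inr e) c \<le> 3" if c: "c \<in> pverts ?C" for c
      proof (cases c)
        case (Inl v)
        then show ?thesis using VW3 WV e c by simp
      next
        case (Inr g)
        then have g: "g \<in> uedges G" using c by simp
        obtain s where s: "s \<in> g" "(x, s) \<notin> parcs G" using non_triangle_vert_edge[OF x g] .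
        \<comment> \<open>The route through \<open>Inl x\<close> costs one step, then at most two
          more because \<open>x\<close> lies in no triangle.\<close>
        have "?d (Inr e) (Inr g) \<le> ?d (Inr e) (Inl x) + ?d (Inl x) (Inr g)"
          using C.gdist_triangle e g xV by simp
        then show ?thesis
          using C.gdist_arc_le[of "Inr e" "Inl x"] VW2[OF xV g s] e xe Inr by simp
      qed
      \<comment> \<open>A common neighbour would be a common end of the disjoint edges
        \<open>e\<close> and \<open>f\<close>.\<close>
      show "3 \<le> ?d (Inr e) (Inr f)"
      proof (rule C.gdist_ge_3)
        show "(w, Inr f) \<notin> parcs ?C" if "(Inr e, w) \<in> parcs ?C" for w
          using that f by (cases w) auto
      qed (use e f xe in auto)
    qed (use e f xe in auto)
    then show ?thesis using Q_edge[of f] f xe Q_step by blast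
  next
    case False
    then have meet: "\<exists>s. s \<in> e \<and> s \<in> f" if "f \<in> uedges G" for f using that by blast
    have far: "?d (Inr e) (Inr f) \<le> 2" if f: "f \<in> uedges G" for f
    proof -
      obtain s where s: "s \<in> e" "s \<in> f" using meet[OF f] by blast
      then show ?thesis
        using via_end[of "Inr e" f s] C.gdist_arc_le[of "Inr e" "Inl s"] e f by simp
    qed
    show ?thesis
    proof (cases "\<exists>u \<in> pverts G. u \<notin> e")
      case True
      then obtain u where u: "u \<in> pverts G" "u \<notin> e" by blast
      have "(Inr e, Inl u) \<in> ?E"
      proof (rule C.ecc_relI[where k = 2])
        show "?d (Inr e) c \<le> 2" if c: "c \<in> pverts ?C" for c
        proof (cases c)
          case (Inr f)
          then show ?thesis using far c by simp
        next
          case (Inl v)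
          then have v: "v \<in> pverts G" using c by simp
          \<comment> \<open>Some end of \<open>e\<close> is not adjacent to \<open>v\<close>:
            otherwise \<open>v\<close> and the two ends of \<open>e\<close> would form a triangle
            through \<open>x\<close>.\<close>
          obtain s where s: "s \<in> e" "(v, s) \<notin> parcs G"
          proof (cases "(v, x) \<in> parcs G")
            case True
            obtain y where y: "e = {x, y}" "(x, y) \<in> parcs G"
              using e by (rule uedgeE) (use xe arcs_symmetric in auto)
            have "(v, y) \<notin> parcs G"
              using non_triangle_vert_edge[OF x uedgeI, of v y] True y arcs_symmetric by blast
            then show ?thesis using that y by blast
          next
            case False
            then show ?thesis using that xe by blast
          qed
          then show ?thesis using VW2[OF v e s] WV[OF v e] Inl by simp
        qed
        show "2 \<le> ?d (Inr e) (Inl u)" by (rule C.gdist_ge_2) (use e u in auto)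
      qed (use e u in auto)
      then show ?thesis using Q_vert[OF u(1)] Q_step by blast
    next
      case False
      \<comment> \<open>With all vertices inside \<open>e\<close>, the graph is a single edge. The
        central graph is then a path on three vertices with \<open>Inr e\<close> in the middle, of
        eccentricity 1.\<close>
      have only: "e = f" if f: "f \<in> uedges G" for f
      proof -
        obtain s t where "e = {s, t}" using e by (rule uedgeE)
        moreover obtain s' t' where "f = {s', t'}" "s' \<in> pverts G" "t' \<in> pverts G" "s' \<noteq> t'"
          using f by (rule uedgeE)
        ultimately show ?thesis using False by auto
      qed
      have "?d (Inr e) c \<le> 1" if c: "c \<in> pverts ?C" for c
      proof (cases c)
        case (Inl v)
        then show ?thesis using C.gdist_arc_le[of "Inr e" c] c e False by auto
      next
        case (Inr f)
        then have "c = Inr e" using only[of f] c by simp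
        then show ?thesis using C.gdist_self[OF c] by simp
      qed
      then have "(Inr e, Inl x) \<in> ?E"
        using e xV by (intro C.ecc_relI[where k = 1] C.gdist_ge_1) auto
      then show ?thesis by blast
    qed
  qed

  have Q: "?Q c" if "c \<in> pverts ?C" for c
    using that Q_vert Q_edge Q_spoke by (cases c) auto
  have "(Inl x, b) \<in> ?E\<^sup>*"
    using Q[OF ab(2)] sym_rtrancl[OF C.sym_ecc_rel] by (rule symD[rotated])
  then show ?thesis using Q[OF ab(1)] by (rule rtrancl_trans[rotated])
qed

end

theorem theorem3p8:
  fixes G :: "'a pair_pre_digraph" and p q :: nat and vs :: "('a + 'a set) list"
  assumes "pair_graph G" and "connected G"
    and "card (pverts G) = p" and "card (uedges G) = q"
    and "distinct vs" and "set vs = pverts (central_graph G)"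
  shows "(triangle_free G \<longrightarrow> irreducible_mat (ecc_mat (central_graph G) vs))
       \<and> (\<not> triangle_free G \<and> non_triangle_verts G \<noteq> {}
            \<longrightarrow> irreducible_mat (ecc_mat (central_graph G) vs))"
proof -
  interpret pair_graph G by fact
  have "irreducible_mat (ecc_mat (central_graph G) vs)" if "non_triangle_verts G \<noteq> {}"
    using that assms(2,5,6) ecc_rel_central_graph_connected by (auto intro: irreducible_ecc_mat)
  \<comment> \<open>Without triangles every vertex qualifies, and connectedness supplies one, so
    both claims follow from the same fact.\<close>
  moreover have "non_triangle_verts G \<noteq> {}" if "triangle_free G"
  proof -
    have "pverts G \<noteq> {}"
      using \<open>connected G\<close> by (auto simp: connected_def strongly_connected_def)
    then show ?thesis using that by (auto simp: non_triangle_verts_def triangle_free_def)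
  qed
  ultimately show ?thesis by blast
qed

end
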